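(* Let $\mathcal{H}$ be a nonzero complex Hilbert space, $n\ge 1$, $A=[a_{ij}]\in\mathcal{M}_n(\mathbb{C})$ and $B\in\mathcal{B}(\mathcal{H})$. If $w(B)=\|B\|$, then $w(A\otimes B)=w(A)\|B\|$. Conversely, if $a_{ij}\ge 0$ for all $i,j$, $a_{ii}\neq 0$ for all $i$, and $w(A\otimes B)=w(A)\|B\|$, then $w(B)=\|B\|$.
   Context: $\mathcal{B}(\mathcal{H})$ denotes the bounded linear operators on the complex Hilbert space $\mathcal{H}$, and $\|\cdot\|$ the operator norm. The numerical radius of a bounded operator $T$ on a complex Hilbert space $\mathcal{K}$ is $w(T)=\sup\{|\langle Tx,x\rangle| : x\in\mathcal{K},\ \|x\|=1\}$; for a matrix in $\mathcal{M}_n(\mathbb{C})$ it is taken on $\mathbb{C}^n$ with the standard inner product. For $A=[a_{ij}]\in\mathcal{M}_n(\mathbb{C})$ and $B\in\mathcal{B}(\mathcal{H})$, the Kronecker product $A\otimes B=[a_{ij}B]_{i,j=1}^n$ is the $n\times n$ operator matrix acting on $\mathcal{H}^n=\mathcal{H}^{\oplus n}$ (Hilbert space direct sum). *)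

theory Defs
  imports "HOL-Analysis.Analysis"
begin

class complex_vector = real_vector +
  fixes scaleC :: "complex \<Rightarrow> 'a \<Rightarrow> 'a"  (infixr \<open>*\<^sub>C\<close> 75)
  assumes scaleC_add_right: "a *\<^sub>C (x + y) = a *\<^sub>C x + a *\<^sub>C y"
    and scaleC_add_left: "(a + b) *\<^sub>C x = a *\<^sub>C x + b *\<^sub>C x"
    and scaleC_scaleC: "a *\<^sub>C b *\<^sub>C x = (a * b) *\<^sub>C x"
    and scaleC_one: "1 *\<^sub>C x = x"
    and scaleR_scaleC: "r *\<^sub>R x = complex_of_real r *\<^sub>C x"

text \<open>The inner product is linear in the first and conjugate-linear in the second argument.\<close>

class complex_inner = complex_vector + real_normed_vector +
  fixes cinner :: "'a \<Rightarrow> 'a \<Rightarrow> complex"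
  assumes cinner_commute: "cinner x y = cnj (cinner y x)"
    and cinner_add_left: "cinner (x + y) z = cinner x z + cinner y z"
    and cinner_scaleC_left: "cinner (a *\<^sub>C x) y = a * cinner x y"
    and cinner_self: "cinner x x = complex_of_real ((norm x)\<^sup>2)"

class complex_hilbert = complex_inner + complete_space

instantiation complex :: complex_hilbert
begin

definition scaleC_complex :: "complex \<Rightarrow> complex \<Rightarrow> complex"
  where "scaleC_complex a x = a * x"

definition cinner_complex :: "complex \<Rightarrow> complex \<Rightarrow> complex"
  where "cinner_complex x y = x * cnj y"

instance
proof
  fix x :: complex
  show "cinner x x = complex_of_real ((norm x)\<^sup>2)"
    by (simp add: cinner_complex_def flip: complex_norm_square)
qed (simp_all add: scaleC_complex_def cinner_complex_def distrib_left distrib_right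
      scaleR_conv_of_real)

end

text \<open>
  The Hilbert space direct sum of copies of \<open>'a\<close> indexed by \<open>'n\<close>. The norm on \<open>'a ^ 'n\<close> is the
  library's \<^const>\<open>L2_set\<close> of the component norms; the instance proof shows that it is the norm of
  the componentwise inner product.
\<close>

instantiation vec :: (complex_vector, finite) complex_vector
begin

definition scaleC_vec :: "complex \<Rightarrow> 'a ^ 'b \<Rightarrow> 'a ^ 'b"
  where "scaleC_vec a x = (\<chi> i. a *\<^sub>C (x $ i))"

instance
  by standard
    (simp_all add: scaleC_vec_def vec_eq_iff scaleC_add_right scaleC_add_left scaleC_scaleC
      scaleC_one scaleR_scaleC)

end

instantiation vec :: (complex_inner, finite) complex_inner
begin

definition cinner_vec :: "'a ^ 'b \<Rightarrow> 'a ^ 'b \<Rightarrow> complex"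
  where "cinner_vec x y = (\<Sum>i\<in>UNIV. cinner (x $ i) (y $ i))"

instance
proof
  fix x y z :: "'a ^ 'b" and a :: complex
  show "cinner x y = cnj (cinner y x)"
    unfolding cinner_vec_def cnj_sum by (rule sum.cong[OF refl], rule cinner_commute)
  show "cinner (x + y) z = cinner x z + cinner y z"
    by (simp add: cinner_vec_def cinner_add_left sum.distrib)
  show "cinner (a *\<^sub>C x) y = a * cinner x y"
    by (simp add: cinner_vec_def scaleC_vec_def cinner_scaleC_left sum_distrib_left)
  show "cinner x x = complex_of_real ((norm x)\<^sup>2)"
    by (simp add: cinner_vec_def cinner_self norm_vec_def L2_set_def sum_nonneg)
qed

end

instance vec :: (complex_hilbert, finite) complex_hilbert ..

definition bounded_clinear :: "('a::complex_inner \<Rightarrow> 'b::complex_inner) \<Rightarrow> bool"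
  where "bounded_clinear T \<longleftrightarrow> bounded_linear T \<and> (\<forall>a x. T (a *\<^sub>C x) = a *\<^sub>C T x)"

definition numerical_radius :: "('a::complex_inner \<Rightarrow> 'a) \<Rightarrow> real"
  where "numerical_radius T = (SUP x\<in>{x. norm x = 1}. cmod (cinner (T x) x))"

text \<open>The operator matrix with blocks \<open>A $ i $ j\<close> times \<open>B\<close>, as an operator on the direct sum.\<close>

definition kronecker_op ::
    "complex ^ 'n ^ 'n \<Rightarrow> ('a::complex_inner \<Rightarrow> 'a) \<Rightarrow> 'a ^ 'n \<Rightarrow> 'a ^ 'n"
  where "kronecker_op A B x = (\<chi> i. \<Sum>j\<in>UNIV. (A $ i $ j) *\<^sub>C B (x $ j))"

end

theory Submission
  imports Defs
begin

text \<open>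
  Three estimates give the theorem. The lower bound \<open>w(A) w(B) \<le> w(A \<otimes> B)\<close> comes from testing
  \<open>A \<otimes> B\<close> on the vectors \<open>c \<otimes> x\<close>, on which the quadratic form factors
  (\<open>numerical_radius_mult_le_kronecker_op\<close>).

  The upper bound \<open>w(A \<otimes> B) \<le> w(A) \<parallel>B\<parallel>\<close> holds for every \<open>B\<close>
  (\<open>numerical_radius_kronecker_op_le\<close>); scale \<open>B\<close> to a contraction. If \<open>Q\<close> is any positive
  semidefinite sesquilinear form, then the Gram matrix of the components of \<open>x\<close> under \<open>Q\<close> is a
  sum of rank-one matrices, so \<open>\<Sum>\<^sub>i\<^sub>j a\<^sub>i\<^sub>j Q(x\<^sub>j, x\<^sub>i)\<close> is a sum of values \<open>\<langle>Av, v\<rangle>\<close> and is at most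
  \<open>w(A) \<Sum>\<^sub>i Q(x\<^sub>i, x\<^sub>i)\<close> in modulus (\<open>semidefinite_matrix_bound\<close>). A contraction is nearly an average
  of such forms with unimodular weights: the Fejer sums
  \<open>Q\<^sub>z(x, y) = \<Sum> (N - \<bar>m\<bar>) z\<^sup>m \<langle>B\<^sup>(\<^sup>m\<^sup>)x, y\<rangle>\<close> over \<open>\<bar>m\<bar> < N\<close>, with \<open>B\<^sup>(\<^sup>-\<^sup>m\<^sup>)\<close> the adjoint of \<open>B\<^sup>m\<close>,
  are semidefinite for \<open>\<bar>z\<bar> = 1\<close>, which is the positivity behind the unitary dilation of \<open>B\<close>.
  Averaging over roots of unity of order above \<open>N\<close> picks out Fourier coefficients:
  \<open>Q\<^sub>z\<close> averages to \<open>N \<langle>x, y\<rangle>\<close>, and \<open>cnj z Q\<^sub>z\<close> to \<open>(N - 1) \<langle>Bx, y\<rangle>\<close>. Hence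
  \<open>(N - 1) \<bar>\<langle>(A \<otimes> B)x, x\<rangle>\<bar> \<le> N w(A) \<parallel>x\<parallel>\<^sup>2\<close> for every \<open>N\<close>, and \<open>N\<close> tends to infinity.

  For the converse, estimate the quadratic form of \<open>A \<otimes> B\<close> entrywise, by \<open>w(B)\<close> on the diagonal
  and by \<open>\<parallel>B\<parallel>\<close> off it. With \<open>t\<^sub>i = \<parallel>x\<^sub>i\<parallel>\<close> and \<open>A\<close> entrywise nonnegative this is at most
  \<open>\<parallel>B\<parallel> \<langle>At, t\<rangle> - (\<parallel>B\<parallel> - w(B)) \<Sum>\<^sub>i a\<^sub>i\<^sub>i t\<^sub>i\<^sup>2\<close>, so a positive diagonal turns \<open>w(B) < \<parallel>B\<parallel>\<close> into
  \<open>w(A \<otimes> B) < w(A) \<parallel>B\<parallel>\<close> (\<open>numerical_radius_kronecker_op_nonneg\<close>).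
\<close>

section \<open>Semidefinite sesquilinear forms\<close>

lemma scaleC_zero_left [simp]: "0 *\<^sub>C (x::'a::complex_vector) = 0"
  using scaleR_scaleC[of 0 x] by simp

lemma scaleC_zero_right [simp]: "a *\<^sub>C (0::'a::complex_vector) = 0"
  using scaleC_add_right[of a "0::'a" 0] by simp

lemma scaleC_sum_right: "a *\<^sub>C (\<Sum>i\<in>I. g i) = (\<Sum>i\<in>I. a *\<^sub>C (g i :: 'a::complex_vector))"
  by (induction I rule: infinite_finite_induct) (auto simp: scaleC_add_right)

text \<open>
  Degenerate forms are allowed, since both the Fejer sums and the Schur complements below have null
  vectors in general.
\<close>

locale semidefinite_form =
  fixes f :: "'a::complex_vector \<Rightarrow> 'a \<Rightarrow> complex"
  assumes commute: "f x y = cnj (f y x)"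
    and add_left: "f (x + y) z = f x z + f y z"
    and scaleC_left: "f (a *\<^sub>C x) y = a * f x y"
    and Re_nonneg: "0 \<le> Re (f x x)"
begin

lemma add_right: "f x (y + z) = f x y + f x z"
  using add_left[of y z x] commute[of x "y + z"] commute[of x y] commute[of x z] by simp

lemma scaleC_right: "f x (a *\<^sub>C y) = cnj a * f x y"
  using scaleC_left[of a y x] commute[of x "a *\<^sub>C y"] commute[of x y] by simp

lemma zero_left [simp]: "f 0 y = 0"
  using scaleC_left[of 0 0 y] by simp

lemma zero_right [simp]: "f y 0 = 0"
  using commute[of y 0] by simp

lemma sum_left: "f (\<Sum>i\<in>I. g i) y = (\<Sum>i\<in>I. f (g i) y)"
  by (induction I rule: infinite_finite_induct) (auto simp: add_left)

lemma sum_right: "f y (\<Sum>i\<in>I. g i) = (\<Sum>i\<in>I. f y (g i))"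
  by (induction I rule: infinite_finite_induct) (auto simp: add_right)

lemma self_of_real: "f x x = complex_of_real (Re (f x x))"
  using commute[of x x] by (metis Reals_cnj_iff of_real_Re)

lemma Cauchy_Schwarz: "(cmod (f x y))\<^sup>2 \<le> Re (f x x) * Re (f y y)"
proof -
  define a b where "a = Re (f x x)" and "b = Re (f y y)"
  define c where "c = f x y"
  have ab: "f x x = of_real a" "f y y = of_real b" "0 \<le> a" "0 \<le> b"
    using self_of_real Re_nonneg by (auto simp: a_def b_def)
  have yx: "f y x = cnj c" using commute c_def by metis
  have expand: "Re (f (x + (- s) *\<^sub>C y) (x + (- s) *\<^sub>C y))
      = a - 2 * Re (cnj s * c) + (cmod s)\<^sup>2 * b" for s
  proof -
    have "f (x + (- s) *\<^sub>C y) (x + (- s) *\<^sub>C y)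
        = of_real a - (cnj s * c + cnj (cnj s * c)) + s * cnj s * of_real b"
      by (simp only: add_left add_right scaleC_left scaleC_right ab yx flip: c_def)
        (simp add: algebra_simps)
    also have "\<dots> = of_real (a - 2 * Re (cnj s * c) + (cmod s)\<^sup>2 * b)"
      by (simp only: complex_add_cnj flip: complex_norm_square) simp
    finally show ?thesis by (metis Re_complex_of_real)
  qed
  have ineq: "2 * Re (cnj s * c) \<le> a + (cmod s)\<^sup>2 * b" for s
    using Re_nonneg[of "x + (- s) *\<^sub>C y"] unfolding expand by simp
  \<comment> \<open>The direction \<open>s = t c\<close> aligns the cross term; \<open>t = 1 / b\<close> minimizes the form along it, and for
    \<open>b = 0\<close> a large \<open>t\<close> rules out \<open>c \<noteq> 0\<close>.\<close>
  have scaled: "2 * t * (cmod c)\<^sup>2 \<le> a + t\<^sup>2 * (cmod c)\<^sup>2 * b" for t :: real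
  proof -
    have eq: "Re (cnj (of_real t * c) * c) = t * (cmod c)\<^sup>2"
      by (simp add: cmod_power2) (simp add: power2_eq_square algebra_simps)
    show ?thesis
      using ineq[of "of_real t * c"] unfolding eq by (simp add: norm_mult power_mult_distrib mult.assoc)
  qed
  show ?thesis
  proof (cases "b = 0")
    case True
    have "cmod c = 0"
    proof (rule ccontr)
      assume "cmod c \<noteq> 0"
      then show False using scaled[of "(a + 1) / (cmod c)\<^sup>2"] True ab by simp
    qed
    then show ?thesis using ab by (simp add: a_def b_def c_def)
  next
    case False
    then have b: "b > 0" using ab by simp
    have "(cmod c)\<^sup>2 / b \<le> a"
      using scaled[of "1 / b"] b by (simp add: power2_eq_square field_simps)
    then show ?thesis using b by (simp add: a_def b_def c_def field_simps)
  qed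
qed

lemma null_vector: "f x x = 0 \<Longrightarrow> f x y = 0"
  using Cauchy_Schwarz[of x y] by simp

text \<open>
  Subtracting the rank-one part through \<open>p\<close> projects onto the orthogonal complement of \<open>p\<close>, and
  Cauchy--Schwarz is exactly the statement that the rest stays nonnegative. If \<open>f p p = 0\<close>, division
  by zero makes the subtracted term vanish, as it should for a null vector.
\<close>

lemma semidefinite_Schur_complement:
  "semidefinite_form (\<lambda>x y. f x y - f x p * f p y / f p p)"
proof
  fix x y z :: 'a and a :: complex
  show "f x y - f x p * f p y / f p p = cnj (f y x - f y p * f p x / f p p)"
    using commute[of x y] commute[of y p] commute[of p x] commute[of p p] by simp
  show "f (x + y) z - f (x + y) p * f p z / f p p
      = (f x z - f x p * f p z / f p p) + (f y z - f y p * f p z / f p p)"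
    by (simp add: add_left add_divide_distrib algebra_simps)
  show "f (a *\<^sub>C x) y - f (a *\<^sub>C x) p * f p y / f p p = a * (f x y - f x p * f p y / f p p)"
    by (simp add: scaleC_left algebra_simps)
  have "f x p * f p x = of_real ((cmod (f x p))\<^sup>2)"
    using commute[of p x] by (metis complex_norm_square)
  then have "f x p * f p x / f p p = of_real ((cmod (f x p))\<^sup>2 / Re (f p p))"
    by (metis self_of_real of_real_divide)
  moreover have "(cmod (f x p))\<^sup>2 / Re (f p p) \<le> Re (f x x)"
    using Cauchy_Schwarz[of x p] Re_nonneg[of p] Re_nonneg[of x]
    by (cases "Re (f p p) = 0") (auto simp: field_simps)
  ultimately show "0 \<le> Re (f x x - f x p * f p x / f p p)" by simp
qed

end

text \<open>
  The Cholesky decomposition: split off the rank-one part through the pivot \<open>x p\<close>; the Schur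
  complement kills \<open>x p\<close>, so the induction hypothesis on the remaining vectors factors the rest.
\<close>

lemma semidefinite_Gram_factorization:
  assumes "finite S" and "semidefinite_form f"
  shows "\<exists>V. \<forall>i\<in>S. \<forall>j\<in>S. f (x i) (x j) = (\<Sum>k\<in>S. V k i * cnj (V k j))"
  using assms
proof (induction S arbitrary: f rule: finite_induct)
  case empty
  then show ?case by simp
next
  case (insert p S)
  interpret semidefinite_form f by (fact insert.prems)
  define r where "r = Re (f (x p) (x p))"
  define g where "g u v = f u v - f u (x p) * f (x p) v / f (x p) (x p)" for u v
  have r: "f (x p) (x p) = of_real r" "0 \<le> r"
    using self_of_real Re_nonneg by (auto simp: r_def)
  interpret g: semidefinite_form g
    unfolding g_def by (rule semidefinite_Schur_complement)
  obtain V where V: "\<forall>i\<in>S. \<forall>j\<in>S. g (x i) (x j) = (\<Sum>k\<in>S. V k i * cnj (V k j))"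
    using insert.IH[OF g.semidefinite_form_axioms] by blast
  have gp: "g (x p) v = 0" "g v (x p) = 0" for v
  proof -
    show "g (x p) v = 0"
      by (cases "f (x p) (x p) = 0") (auto simp: g_def null_vector)
    then show "g v (x p) = 0" using g.commute[of v "x p"] by simp
  qed
  define W where "W k i =
    (if k = p then f (x i) (x p) / of_real (sqrt r) else if i = p then 0 else V k i)" for k i
  \<comment> \<open>For \<open>r = 0\<close> both sides vanish by division by zero.\<close>
  have pivot: "W p i * cnj (W p j) = f (x i) (x j) - g (x i) (x j)" for i j
  proof -
    have "complex_of_real (sqrt r) * of_real (sqrt r) = f (x p) (x p)"
      using r by (simp flip: of_real_mult)
    moreover have "cnj (f (x j) (x p)) = f (x p) (x j)" by (metis commute)
    ultimately show ?thesis by (simp add: W_def g_def)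
  qed
  have rest: "(\<Sum>k\<in>S. W k i * cnj (W k j)) = g (x i) (x j)"
    if "i \<in> insert p S" "j \<in> insert p S" for i j
  proof (cases "i = p \<or> j = p")
    case True
    have "(\<Sum>k\<in>S. W k i * cnj (W k j)) = 0"
      using True insert.hyps by (intro sum.neutral) (auto simp: W_def)
    then show ?thesis using True gp by auto
  next
    case False
    then have "(\<Sum>k\<in>S. W k i * cnj (W k j)) = (\<Sum>k\<in>S. V k i * cnj (V k j))"
      using insert.hyps by (intro sum.cong) (auto simp: W_def)
    then show ?thesis using False that V by auto
  qed
  have "\<forall>i\<in>insert p S. \<forall>j\<in>insert p S.
      f (x i) (x j) = (\<Sum>k\<in>insert p S. W k i * cnj (W k j))"
    using insert.hyps rest pivot by (simp add: sum.insert)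
  then show ?case by blast
qed

section \<open>Inner product and numerical radius\<close>

interpretation cinner: semidefinite_form "cinner :: 'a::complex_inner \<Rightarrow> 'a \<Rightarrow> complex"
proof
  show "cinner x y = cnj (cinner y x)" for x y :: 'a by (rule cinner_commute)
qed (simp_all add: cinner_add_left cinner_scaleC_left cinner_self)

lemma cmod_cinner_le: "cmod (cinner x y) \<le> norm (x::'a::complex_inner) * norm y"
proof (rule power2_le_imp_le)
  show "(cmod (cinner x y))\<^sup>2 \<le> (norm x * norm y)\<^sup>2"
    using cinner.Cauchy_Schwarz[of x y] by (simp add: cinner_self power_mult_distrib)
qed simp

lemma norm_scaleC: "norm (a *\<^sub>C (x::'a::complex_inner)) = cmod a * norm x"
proof -
  have "complex_of_real ((norm (a *\<^sub>C x))\<^sup>2) = of_real ((cmod a * norm x)\<^sup>2)"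
    unfolding cinner_self[symmetric] cinner_scaleC_left cinner.scaleC_right
    using complex_norm_square[of a] by (simp add: cinner_self power_mult_distrib)
  then show ?thesis
    by (metis norm_ge_zero mult_nonneg_nonneg of_real_eq_iff power2_eq_iff_nonneg)
qed

lemma bounded_clinearD:
  assumes "bounded_clinear T"
  shows "bounded_linear T" and "T (x + y) = T x + T y" and "T (a *\<^sub>C x) = a *\<^sub>C T x"
  using assms linear_simps(1)[of T] by (auto simp: bounded_clinear_def)

lemma cmod_cinner_le_onorm:
  assumes "bounded_linear T"
  shows "cmod (cinner (T x) y) \<le> onorm T * (norm x * norm y)"
proof -
  have "cmod (cinner (T x) y) \<le> norm (T x) * norm y" by (rule cmod_cinner_le)
  also have "\<dots> \<le> (onorm T * norm x) * norm y"
    by (intro mult_right_mono onorm assms) simp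
  finally show ?thesis by (simp add: mult.assoc)
qed

lemma bdd_above_numerical_range:
  fixes T :: "'a::complex_inner \<Rightarrow> 'a"
  assumes "bounded_linear T"
  shows "bdd_above ((\<lambda>x. cmod (cinner (T x) x)) ` {x. norm x = 1})"
proof (rule bdd_aboveI2)
  fix x :: 'a
  assume "x \<in> {x. norm x = 1}"
  then show "cmod (cinner (T x) x) \<le> onorm T"
    using cmod_cinner_le_onorm[OF assms, of x x] by simp
qed

lemma ex_unit_vector:
  assumes "\<exists>x::'a::real_normed_vector. x \<noteq> 0"
  shows "\<exists>x::'a. norm x = 1"
proof -
  obtain x :: 'a where "x \<noteq> 0" using assms by blast
  then have "norm (sgn x) = 1" by (simp add: norm_sgn)
  then show ?thesis by blast
qed

lemma numerical_radius_least:
  fixes T :: "'a::complex_inner \<Rightarrow> 'a"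
  assumes "\<exists>x::'a. x \<noteq> 0" and "\<And>x. norm x = 1 \<Longrightarrow> cmod (cinner (T x) x) \<le> c"
  shows "numerical_radius T \<le> c"
  unfolding numerical_radius_def
  using ex_unit_vector[OF assms(1)] assms(2) by (intro cSUP_least) auto

lemma cmod_cinner_le_numerical_radius:
  fixes T :: "'a::complex_inner \<Rightarrow> 'a"
  assumes "bounded_clinear T"
  shows "cmod (cinner (T x) x) \<le> numerical_radius T * (norm x)\<^sup>2"
proof (cases "x = 0")
  case True
  then show ?thesis by simp
next
  case False
  define u where "u = complex_of_real (1 / norm x) *\<^sub>C x"
  have "norm u = 1" using False by (simp add: u_def norm_scaleC norm_divide)
  then have "cmod (cinner (T u) u) \<le> numerical_radius T"
    unfolding numerical_radius_def
    by (intro cSUP_upper bdd_above_numerical_range bounded_clinearD(1) assms) simp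
  moreover have "cmod (cinner (T u) u) = cmod (cinner (T x) x) / (norm x)\<^sup>2"
    unfolding u_def bounded_clinearD(3)[OF assms] cinner_scaleC_left cinner.scaleC_right
    by (simp add: norm_mult norm_divide power2_eq_square)
  ultimately show ?thesis using False by (simp add: field_simps)
qed

lemma numerical_radius_nonneg:
  fixes T :: "'a::complex_inner \<Rightarrow> 'a"
  assumes "\<exists>x::'a. x \<noteq> 0" and "bounded_clinear T"
  shows "0 \<le> numerical_radius T"
proof -
  obtain x :: 'a where "norm x = 1" using ex_unit_vector[OF assms(1)] by blast
  then have "cmod (cinner (T x) x) \<le> numerical_radius T"
    using cmod_cinner_le_numerical_radius[OF assms(2), of x] by simp
  then show ?thesis using norm_ge_zero order_trans by blast
qed

lemma numerical_radius_le_onorm: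
  fixes T :: "'a::complex_inner \<Rightarrow> 'a"
  assumes "\<exists>x::'a. x \<noteq> 0" and "bounded_linear T"
  shows "numerical_radius T \<le> onorm T"
  using cmod_cinner_le_onorm[OF assms(2), of x x for x]
  by (intro numerical_radius_least assms(1)) (metis mult.right_neutral)

section \<open>Kronecker products\<close>

lemma norm_vec_square: "(norm (x :: 'a::real_normed_vector ^ 'n))\<^sup>2 = (\<Sum>i\<in>UNIV. (norm (x $ i))\<^sup>2)"
  by (simp add: norm_vec_def L2_set_def sum_nonneg)

lemma cinner_kronecker_op:
  "cinner (kronecker_op A B x) x = (\<Sum>i\<in>UNIV. \<Sum>j\<in>UNIV. A $ i $ j * cinner (B (x $ j)) (x $ i))"
  by (simp add: cinner_vec_def kronecker_op_def cinner.sum_left cinner_scaleC_left)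

lemma bounded_clinear_kronecker_op:
  fixes A :: "complex ^ 'n ^ 'n" and B :: "'a::complex_inner \<Rightarrow> 'a"
  assumes B: "bounded_clinear B"
  shows "bounded_clinear (kronecker_op A B)"
proof -
  note B_simps = bounded_clinearD(2,3)[OF B]
  have add: "kronecker_op A B (x + y) = kronecker_op A B x + kronecker_op A B y" for x y
    by (simp add: kronecker_op_def vec_eq_iff B_simps scaleC_add_right sum.distrib)
  have scale: "kronecker_op A B (a *\<^sub>C x) = a *\<^sub>C kronecker_op A B x" for a x
    by (simp add: kronecker_op_def vec_eq_iff scaleC_vec_def B_simps scaleC_sum_right
        scaleC_scaleC mult.commute)
  have bound: "norm (kronecker_op A B x)
      \<le> norm x * (\<Sum>i\<in>UNIV. \<Sum>j\<in>UNIV. cmod (A $ i $ j) * onorm B)" for x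
  proof -
    have "norm (kronecker_op A B x) \<le> (\<Sum>i\<in>UNIV. norm (kronecker_op A B x $ i))"
      unfolding norm_vec_def by (rule L2_set_le_sum) simp
    also have "\<dots> \<le> (\<Sum>i\<in>UNIV. \<Sum>j\<in>UNIV. cmod (A $ i $ j) * (onorm B * norm x))"
    proof (rule sum_mono)
      fix i
      have "norm (kronecker_op A B x $ i) \<le> (\<Sum>j\<in>UNIV. norm ((A $ i $ j) *\<^sub>C B (x $ j)))"
        unfolding kronecker_op_def by (simp add: norm_sum)
      also have "\<dots> \<le> (\<Sum>j\<in>UNIV. cmod (A $ i $ j) * (onorm B * norm x))"
      proof (rule sum_mono)
        fix j
        have "norm (B (x $ j)) \<le> onorm B * norm (x $ j)"
          by (rule onorm[OF bounded_clinearD(1)[OF B]])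
        also have "\<dots> \<le> onorm B * norm x"
          by (intro mult_left_mono Finite_Cartesian_Product.norm_nth_le onorm_pos_le bounded_clinearD(1) B)
        finally show "norm ((A $ i $ j) *\<^sub>C B (x $ j)) \<le> cmod (A $ i $ j) * (onorm B * norm x)"
          by (simp add: norm_scaleC mult_left_mono)
      qed
      finally show "norm (kronecker_op A B x $ i)
          \<le> (\<Sum>j\<in>UNIV. cmod (A $ i $ j) * (onorm B * norm x))" .
    qed
    also have "\<dots> = norm x * (\<Sum>i\<in>UNIV. \<Sum>j\<in>UNIV. cmod (A $ i $ j) * onorm B)"
      by (simp add: sum_distrib_left algebra_simps)
    finally show ?thesis .
  qed
  have "bounded_linear (kronecker_op A B)"
    by (rule bounded_linear_intro[OF add _ bound]) (simp add: scaleR_scaleC scale)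
  then show ?thesis by (simp add: bounded_clinear_def scale)
qed

lemma matrix_vector_mult_eq_kronecker_op: "(\<lambda>x. A *v x) = kronecker_op A (\<lambda>z::complex. z)"
  by (simp add: fun_eq_iff matrix_vector_mult_def kronecker_op_def scaleC_complex_def)

lemma bounded_clinear_matrix_vector_mult:
  fixes A :: "complex ^ 'n ^ 'n"
  shows "bounded_clinear (\<lambda>x. A *v x)"
proof -
  have "bounded_clinear (\<lambda>z::complex. z)" by (simp add: bounded_clinear_def)
  from bounded_clinear_kronecker_op[OF this, of A] show ?thesis
    by (simp only: matrix_vector_mult_eq_kronecker_op[of A, symmetric])
qed

lemma cinner_matrix_vector_mult:
  "cinner (A *v x) (x :: complex ^ 'n) = (\<Sum>i\<in>UNIV. \<Sum>j\<in>UNIV. A $ i $ j * (x $ j * cnj (x $ i)))"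
  using cinner_kronecker_op[of A "\<lambda>z. z" x]
  by (simp add: matrix_vector_mult_eq_kronecker_op[THEN fun_cong] cinner_complex_def)

text \<open>On \<open>c \<otimes> x\<close> the quadratic form of \<open>A \<otimes> B\<close> is \<open>\<langle>Ac, c\<rangle> \<langle>Bx, x\<rangle>\<close>.\<close>

lemma numerical_radius_mult_le_kronecker_op:
  fixes A :: "complex ^ 'n ^ 'n" and B :: "'a::complex_inner \<Rightarrow> 'a"
  assumes nz: "\<exists>x::'a. x \<noteq> 0" and B: "bounded_clinear B"
  shows "numerical_radius (\<lambda>x. A *v x) * numerical_radius B \<le> numerical_radius (kronecker_op A B)"
proof -
  let ?W = "numerical_radius (kronecker_op A B)"
  have product: "cmod (cinner (A *v c) c) * cmod (cinner (B x) x) \<le> ?W"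
    if c: "norm c = 1" and x: "norm x = 1" for c :: "complex ^ 'n" and x :: 'a
  proof -
    define z where "z = (\<chi> i. (c $ i) *\<^sub>C x)"
    have "(norm z)\<^sup>2 = (norm c)\<^sup>2 * (norm x)\<^sup>2"
      by (simp add: norm_vec_square z_def norm_scaleC power_mult_distrib sum_distrib_right)
    moreover have "cinner (kronecker_op A B z) z = cinner (A *v c) c * cinner (B x) x"
      by (simp add: cinner_kronecker_op cinner_matrix_vector_mult z_def bounded_clinearD(3)[OF B]
          cinner_scaleC_left cinner.scaleC_right sum_distrib_left sum_distrib_right mult_ac)
    ultimately show ?thesis
      using cmod_cinner_le_numerical_radius[OF bounded_clinear_kronecker_op[OF B], of A z] c x
      by (simp add: norm_mult)
  qed
  have nzc: "\<exists>c :: complex ^ 'n. c \<noteq> 0" by (intro exI[of _ 1]) simp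
  \<comment> \<open>Take the supremum over \<open>x\<close> first, then over \<open>c\<close>; each time the fixed factor is divided out,
    so its vanishing is a separate case.\<close>
  have "numerical_radius B * cmod (cinner (A *v c) c) \<le> ?W" if c: "norm c = 1" for c :: "complex ^ 'n"
  proof (cases "cinner (A *v c) c = 0")
    case True
    obtain x :: 'a where "norm x = 1" using ex_unit_vector[OF nz] by blast
    from product[OF c this] True show ?thesis by simp
  next
    case False
    then have "numerical_radius B \<le> ?W / cmod (cinner (A *v c) c)"
      using product[OF c] by (intro numerical_radius_least nz) (simp add: field_simps)
    with False show ?thesis by (simp add: field_simps)
  qed
  note fixed = this
  show ?thesis
  proof (cases "numerical_radius B = 0")
    case True
    obtain c :: "complex ^ 'n" where "norm c = 1" using ex_unit_vector[OF nzc] by blast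
    from fixed[OF this] True show ?thesis by simp
  next
    case False
    then have pos: "0 < numerical_radius B" using numerical_radius_nonneg[OF nz B] by simp
    then have "numerical_radius (\<lambda>x. A *v x) \<le> ?W / numerical_radius B"
      using fixed by (intro numerical_radius_least nzc) (simp add: field_simps)
    with pos show ?thesis by (simp add: field_simps)
  qed
qed

text \<open>
  A Gram factorization \<open>f (x i) (x j) = \<Sum>\<^sub>k V k i * cnj (V k j)\<close> turns the left-hand side into
  \<open>\<Sum>\<^sub>k \<langle>A (V k), V k\<rangle>\<close>, while the squared norms of the \<open>V k\<close> add up to the trace on the right.
\<close>

lemma semidefinite_matrix_bound:
  fixes A :: "complex ^ 'n ^ 'n" and f :: "'a::complex_vector \<Rightarrow> 'a \<Rightarrow> complex"
  assumes "semidefinite_form f"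
  shows "cmod (\<Sum>i\<in>UNIV. \<Sum>j\<in>UNIV. A $ i $ j * f (x j) (x i))
    \<le> numerical_radius (\<lambda>x. A *v x) * (\<Sum>i\<in>UNIV. Re (f (x i) (x i)))"
proof -
  obtain V :: "'n \<Rightarrow> 'n \<Rightarrow> complex"
    where V: "\<And>i j. f (x i) (x j) = (\<Sum>k\<in>UNIV. V k i * cnj (V k j))"
    using semidefinite_Gram_factorization[OF finite_class.finite_UNIV assms, of x] by auto
  define v where "v k = (\<chi> i. V k i)" for k
  have "(\<Sum>i\<in>UNIV. \<Sum>j\<in>UNIV. A $ i $ j * f (x j) (x i))
      = (\<Sum>i\<in>UNIV. \<Sum>j\<in>UNIV. \<Sum>k\<in>UNIV. A $ i $ j * (V k j * cnj (V k i)))"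
    by (simp add: V sum_distrib_left)
  also have "\<dots> = (\<Sum>i\<in>UNIV. \<Sum>k\<in>UNIV. \<Sum>j\<in>UNIV. A $ i $ j * (V k j * cnj (V k i)))"
    by (intro sum.cong refl sum.swap)
  also have "\<dots> = (\<Sum>k\<in>UNIV. \<Sum>i\<in>UNIV. \<Sum>j\<in>UNIV. A $ i $ j * (V k j * cnj (V k i)))"
    by (rule sum.swap)
  also have "\<dots> = (\<Sum>k\<in>UNIV. cinner (A *v v k) (v k))"
    by (simp add: cinner_matrix_vector_mult v_def)
  finally have "cmod (\<Sum>i\<in>UNIV. \<Sum>j\<in>UNIV. A $ i $ j * f (x j) (x i))
      \<le> (\<Sum>k\<in>UNIV. cmod (cinner (A *v v k) (v k)))"
    by (simp add: norm_sum)
  also have "\<dots> \<le> (\<Sum>k\<in>UNIV. numerical_radius (\<lambda>x. A *v x) * (norm (v k))\<^sup>2)"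
    by (intro sum_mono cmod_cinner_le_numerical_radius bounded_clinear_matrix_vector_mult)
  also have "\<dots> = numerical_radius (\<lambda>x. A *v x) * (\<Sum>k\<in>UNIV. \<Sum>i\<in>UNIV. (cmod (V k i))\<^sup>2)"
    by (simp add: sum_distrib_left norm_vec_square v_def)
  also have "(\<Sum>k\<in>UNIV. \<Sum>i\<in>UNIV. (cmod (V k i))\<^sup>2) = (\<Sum>i\<in>UNIV. \<Sum>k\<in>UNIV. (cmod (V k i))\<^sup>2)"
    by (rule sum.swap)
  also have "\<dots> = (\<Sum>i\<in>UNIV. Re (f (x i) (x i)))"
    by (simp add: V flip: complex_norm_square)
  finally show ?thesis .
qed

section \<open>Fejer means of a contraction\<close>

definition orbit_sum :: "complex \<Rightarrow> ('a::complex_vector \<Rightarrow> 'a) \<Rightarrow> nat \<Rightarrow> 'a \<Rightarrow> 'a"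
  where "orbit_sum z B k x = (\<Sum>j<k. z ^ j *\<^sub>C (B ^^ j) x)"

text \<open>
  Up to the missing factor \<open>1 / N\<close> this is the Fejer mean of the sequence of powers of \<open>B\<close>,
  continued to negative indices by adjoints: collecting powers gives weight \<open>N - j\<close> to
  \<open>z ^ j * cinner ((B ^^ j) x) y\<close> and to \<open>cnj z ^ j * cinner x ((B ^^ j) y)\<close>. Moving the powers to the
  second argument avoids the adjoint operator, and grouping by \<open>k\<close> makes positivity a telescoping sum.
\<close>

definition fejer_form ::
    "complex \<Rightarrow> ('a::complex_inner \<Rightarrow> 'a) \<Rightarrow> nat \<Rightarrow> 'a \<Rightarrow> 'a \<Rightarrow> complex"
  where "fejer_form z B N x y =
    (\<Sum>k<N. cinner (orbit_sum z B (Suc k) x) y + cinner x (orbit_sum z B (Suc k) y) - cinner x y)"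

lemma orbit_sum_Suc:
  assumes "bounded_clinear B"
  shows "orbit_sum z B (Suc k) x = x + z *\<^sub>C B (orbit_sum z B k x)"
proof -
  have "B (orbit_sum z B k x) = (\<Sum>j<k. z ^ j *\<^sub>C (B ^^ Suc j) x)"
    unfolding orbit_sum_def
    using bounded_linear.linear[OF bounded_clinearD(1)[OF assms]]
    by (simp add: linear_sum bounded_clinearD(3)[OF assms])
  then show ?thesis
    unfolding orbit_sum_def sum.lessThan_Suc_shift
    by (simp add: scaleC_sum_right scaleC_scaleC scaleC_one)
qed

lemma orbit_sum_add:
  assumes "bounded_clinear B"
  shows "orbit_sum z B k (x + y) = orbit_sum z B k x + orbit_sum z B k y"
proof (induction k)
  case 0
  then show ?case by (simp add: orbit_sum_def)
next
  case (Suc k)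
  then show ?case
    by (simp add: orbit_sum_Suc[OF assms] bounded_clinearD(2)[OF assms] scaleC_add_right)
qed

lemma orbit_sum_scaleC:
  assumes "bounded_clinear B"
  shows "orbit_sum z B k (a *\<^sub>C x) = a *\<^sub>C orbit_sum z B k x"
proof (induction k)
  case 0
  then show ?case by (simp add: orbit_sum_def)
next
  case (Suc k)
  then show ?case
    by (simp add: orbit_sum_Suc[OF assms] bounded_clinearD(3)[OF assms] scaleC_add_right
        scaleC_scaleC mult.commute)
qed

text \<open>
  Let \<open>s k\<close> be the orbit sum at \<open>x\<close>. Since \<open>s (k + 1) = x + z B (s k)\<close>, completing the square shows
  that the \<open>k\<close>-th summand of \<open>fejer_form z B N x x\<close> is
  \<open>\<parallel>s (k + 1)\<parallel>\<^sup>2 - \<parallel>B (s k)\<parallel>\<^sup>2 \<ge> \<parallel>s (k + 1)\<parallel>\<^sup>2 - \<parallel>s k\<parallel>\<^sup>2\<close>, so the total is at least \<open>\<parallel>s N\<parallel>\<^sup>2\<close>.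
\<close>

lemma semidefinite_fejer_form:
  assumes B: "bounded_clinear B" and contr: "\<And>x. norm (B x) \<le> norm x" and z: "cmod z = 1"
  shows "semidefinite_form (fejer_form z B N)"
proof
  fix x y w and a :: complex
  show "fejer_form z B N x y = cnj (fejer_form z B N y x)"
    unfolding fejer_form_def cnj_sum
  proof (rule sum.cong[OF refl])
    fix k
    show "cinner (orbit_sum z B (Suc k) x) y + cinner x (orbit_sum z B (Suc k) y) - cinner x y
      = cnj (cinner (orbit_sum z B (Suc k) y) x + cinner y (orbit_sum z B (Suc k) x) - cinner y x)"
      using cinner_commute[of x y] cinner_commute[of "orbit_sum z B (Suc k) x" y]
        cinner_commute[of x "orbit_sum z B (Suc k) y"] by simp
  qed
  show "fejer_form z B N (x + y) w = fejer_form z B N x w + fejer_form z B N y w"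
    unfolding fejer_form_def orbit_sum_add[OF B]
    by (simp add: cinner_add_left algebra_simps flip: sum.distrib)
  show "fejer_form z B N (a *\<^sub>C x) y = a * fejer_form z B N x y"
    unfolding fejer_form_def orbit_sum_scaleC[OF B]
    by (simp add: cinner_scaleC_left algebra_simps sum_distrib_left)
  define s where "s k = orbit_sum z B k x" for k
  have "(norm (s (Suc k)))\<^sup>2 - (norm (s k))\<^sup>2
      \<le> Re (cinner (s (Suc k)) x + cinner x (s (Suc k)) - cinner x x)" for k
  proof -
    define b where "b = z *\<^sub>C B (s k)"
    have s: "s (Suc k) = x + b" by (simp add: s_def b_def orbit_sum_Suc[OF B])
    have "norm b \<le> norm (s k)" using contr[of "s k"] z by (simp add: b_def norm_scaleC)
    then have "Re (cinner b b) \<le> (norm (s k))\<^sup>2" by (simp add: cinner_self power_mono)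
    moreover have "(norm (s (Suc k)))\<^sup>2 = Re (cinner (x + b) (x + b))"
      by (simp add: cinner_self s)
    ultimately show ?thesis
      unfolding s by (simp add: cinner_add_left cinner.add_right)
  qed
  then have "(\<Sum>k<N. (norm (s (Suc k)))\<^sup>2 - (norm (s k))\<^sup>2) \<le> Re (fejer_form z B N x x)"
    unfolding fejer_form_def s_def Re_sum by (intro sum_mono)
  moreover have "(\<Sum>k<N. (norm (s (Suc k)))\<^sup>2 - (norm (s k))\<^sup>2) = (norm (s N))\<^sup>2"
    by (subst sum_lessThan_telescope) (simp add: s_def orbit_sum_def)
  ultimately show "0 \<le> Re (fejer_form z B N x x)"
    by (metis order_trans zero_le_power2)
qed

lemma cmod_root_unity: "z ^ M = 1 \<Longrightarrow> 0 < M \<Longrightarrow> cmod z = 1"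
  by (metis norm_one norm_power norm_ge_zero power_eq_1_iff less_numeral_extra(3))

lemma roots_unity_orthogonal:
  assumes "a < M" and "b < M"
  shows "(\<Sum>z | z ^ M = 1. cnj z ^ a * z ^ b) = (if a = b then of_nat M else (0::complex))"
proof -
  have M: "M > 0" using assms by simp
  have cnj: "cnj z * z = 1" if "z ^ M = 1" for z :: complex
    using cmod_root_unity[OF that M] complex_norm_square[of z] by (simp add: mult.commute)
  show ?thesis
  proof (cases "a = b")
    case True
    have "(\<Sum>z | z ^ M = 1. cnj z ^ a * z ^ b) = (\<Sum>z::complex | z ^ M = 1. 1)"
      using True cnj by (intro sum.cong) (auto simp flip: power_mult_distrib)
    then show ?thesis using True M by (simp add: card_roots_unity_eq)
  next
    case False
    define w where "w = cis (2 * pi / real M)"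
    have "w ^ M = cis (real M * (2 * pi / real M))" by (simp only: w_def Complex.DeMoivre)
    also have "\<dots> = cis (2 * pi)" using M by simp
    finally have wM: "w ^ M = 1" by simp
    have inj: "w ^ a \<noteq> w ^ b"
    proof
      assume "w ^ a = w ^ b"
      then have "cis (2 * pi * real a / real M) = cis (2 * pi * real b / real M)"
        by (simp add: w_def Complex.DeMoivre mult_ac)
      with bij_betw_imp_inj_on[OF Complex.bij_betw_roots_unity[OF M]] assms have "a = b"
        by (auto dest: inj_onD)
      with False show False by simp
    qed
    have w0: "w \<noteq> 0" by (simp add: w_def)
    let ?S = "\<Sum>z | z ^ M = 1. cnj z ^ a * z ^ b"
    \<comment> \<open>Multiplication by the primitive root \<open>w\<close> permutes the roots of unity and scales the sum by a
      factor other than 1, so the sum vanishes.\<close>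
    have bij: "bij_betw (\<lambda>z. w * z) {z. z ^ M = 1} {z. z ^ M = 1}"
    proof (rule bij_betw_byWitness[where f' = "\<lambda>z. z / w"])
    qed (auto simp: w0 wM power_mult_distrib power_divide)
    have "?S = (\<Sum>z | z ^ M = 1. cnj (w * z) ^ a * (w * z) ^ b)"
      by (rule sum.reindex_bij_betw[OF bij, symmetric])
    also have "\<dots> = (cnj w ^ a * w ^ b) * ?S"
      by (simp add: sum_distrib_left power_mult_distrib mult_ac)
    finally have "(1 - cnj w ^ a * w ^ b) * ?S = 0" by (simp add: algebra_simps)
    moreover have "cnj w ^ a * w ^ b \<noteq> 1"
    proof
      assume eq: "cnj w ^ a * w ^ b = 1"
      have "w ^ b = (cnj w * w) ^ a * w ^ b" by (simp add: cnj[OF wM])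
      also have "\<dots> = w ^ a * (cnj w ^ a * w ^ b)" by (simp add: power_mult_distrib mult_ac)
      finally show False using inj eq by simp
    qed
    ultimately show ?thesis using False by simp
  qed
qed

lemma fejer_form_expand:
  "fejer_form z B N x y = (\<Sum>k<N.
     (\<Sum>j\<le>k. z ^ j * cinner ((B ^^ j) x) y) + (\<Sum>j\<le>k. cnj z ^ j * cinner x ((B ^^ j) y)) - cinner x y)"
  by (simp add: fejer_form_def orbit_sum_def cinner.sum_left cinner.sum_right cinner_scaleC_left
      cinner.scaleC_right lessThan_Suc_atMost del: sum.lessThan_Suc)

text \<open>
  Extraction of the Fourier coefficients of index \<open>a = 0\<close> and \<open>a = 1\<close>. Since \<open>cnj z ^ a * cnj z ^ j\<close>
  with \<open>j < N\<close> has total degree at most \<open>N\<close>, the bound \<open>N < M\<close> prevents aliasing modulo \<open>M\<close>.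
\<close>

lemma sum_roots_unity_fejer_form:
  assumes N: "N < M" and a: "a \<le> 1" and M: "1 < M"
  shows "(\<Sum>z | z ^ M = 1. cnj z ^ a * fejer_form z B N x y)
    = of_nat M * of_nat (N - a) * cinner ((B ^^ a) x) y"
proof -
  let ?R = "{z::complex. z ^ M = 1}"
  have root_average: "(\<Sum>z\<in>?R. cnj z ^ a * ((\<Sum>j\<le>k. z ^ j * cinner ((B ^^ j) x) y)
        + (\<Sum>j\<le>k. cnj z ^ j * cinner x ((B ^^ j) y)) - cinner x y))
      = (if a \<le> k then of_nat M * cinner ((B ^^ a) x) y else 0)" if k: "k < N" for k
  proof -
    have "(\<Sum>z\<in>?R. cnj z ^ a * ((\<Sum>j\<le>k. z ^ j * cinner ((B ^^ j) x) y)
          + (\<Sum>j\<le>k. cnj z ^ j * cinner x ((B ^^ j) y)) - cinner x y))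
        = (\<Sum>j\<le>k. (\<Sum>z\<in>?R. cnj z ^ a * z ^ j) * cinner ((B ^^ j) x) y)
        + (\<Sum>j\<le>k. (\<Sum>z\<in>?R. cnj z ^ (a + j) * z ^ 0) * cinner x ((B ^^ j) y))
        - (\<Sum>z\<in>?R. cnj z ^ a * z ^ 0) * cinner x y"
      by (simp add: distrib_left right_diff_distrib sum.distrib sum_subtractf sum_distrib_left
          sum_distrib_right power_add mult.assoc sum.swap[of _ ?R])
    also have "(\<Sum>j\<le>k. (\<Sum>z\<in>?R. cnj z ^ a * z ^ j) * cinner ((B ^^ j) x) y)
        = (\<Sum>j\<le>k. if j = a then of_nat M * cinner ((B ^^ j) x) y else 0)"
      using k N a M by (intro sum.cong refl) (simp add: roots_unity_orthogonal)
    also have "\<dots> = (if a \<le> k then of_nat M * cinner ((B ^^ a) x) y else 0)"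
      by simp
    also have "(\<Sum>j\<le>k. (\<Sum>z\<in>?R. cnj z ^ (a + j) * z ^ 0) * cinner x ((B ^^ j) y))
        = (\<Sum>j\<le>k. if j = 0 then (if a = 0 then of_nat M * cinner x ((B ^^ j) y) else 0) else 0)"
      using k N a M
      by (intro sum.cong refl) (subst roots_unity_orthogonal, auto)
    also have "\<dots> = (if a = 0 then of_nat M * cinner x y else 0)"
      by simp
    also have "(\<Sum>z\<in>?R. cnj z ^ a * z ^ 0) = (if a = 0 then of_nat M else 0)"
      using a M by (subst roots_unity_orthogonal) auto
    finally show ?thesis by (simp split: if_splits)
  qed
  have "(\<Sum>z\<in>?R. cnj z ^ a * fejer_form z B N x y)
      = (\<Sum>k<N. if a \<le> k then of_nat M * cinner ((B ^^ a) x) y else 0)"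
    unfolding fejer_form_expand sum_distrib_left
    by (subst sum.swap) (intro sum.cong refl, simp only: root_average lessThan_iff)
  also have "\<dots> = (\<Sum>k\<in>{a..<N}. of_nat M * cinner ((B ^^ a) x) y)"
    by (rule sum.mono_neutral_cong_right) auto
  finally show ?thesis by simp
qed

text \<open>
  The bound for semidefinite forms is applied to the Fejer form at each root of unity; the weighted
  average of the left-hand sides recovers \<open>A \<otimes> B\<close>, the average of the right-hand sides the norm,
  and the factor \<open>(N + 1) / N\<close> lost between them tends to 1.
\<close>

lemma cmod_cinner_kronecker_contraction:
  fixes A :: "complex ^ 'n ^ 'n" and B :: "'a::complex_inner \<Rightarrow> 'a"
  assumes B: "bounded_clinear B" and contr: "\<And>x. norm (B x) \<le> norm x"
  shows "cmod (cinner (kronecker_op A B x) x) \<le> numerical_radius (\<lambda>x. A *v x) * (norm x)\<^sup>2"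
proof -
  let ?w = "numerical_radius (\<lambda>x. A *v x)"
  define p where "p = cmod (cinner (kronecker_op A B x) x)"
  have fejer_bound: "real N * p \<le> real (Suc N) * (?w * (norm x)\<^sup>2)" for N
  proof -
    define M where "M = Suc (Suc N)"
    let ?R = "{z::complex. z ^ M = 1}"
    let ?F = "\<lambda>z. fejer_form z B (Suc N)"
    have M: "Suc N < M" "1 < M" by (auto simp: M_def)
    have unit: "cmod z = 1" if "z \<in> ?R" for z
      using that M cmod_root_unity[of z M] by auto
    have "(\<Sum>z\<in>?R. cnj z ^ 1 * (\<Sum>i\<in>UNIV. \<Sum>j\<in>UNIV. A $ i $ j * ?F z (x $ j) (x $ i)))
        = (\<Sum>i\<in>UNIV. \<Sum>j\<in>UNIV. A $ i $ j * (\<Sum>z\<in>?R. cnj z ^ 1 * ?F z (x $ j) (x $ i)))"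
      by (simp add: sum_distrib_left sum.swap[of _ ?R] mult_ac)
    also have "\<dots> = of_nat M * of_nat N * cinner (kronecker_op A B x) x"
      unfolding sum_roots_unity_fejer_form[OF M(1) order_refl M(2)] cinner_kronecker_op
      by (simp add: sum_distrib_left mult_ac)
    finally have "real M * real N * p
        = cmod (\<Sum>z\<in>?R. cnj z ^ 1 * (\<Sum>i\<in>UNIV. \<Sum>j\<in>UNIV. A $ i $ j * ?F z (x $ j) (x $ i)))"
      by (simp add: p_def norm_mult del: of_nat_Suc)
    also have "\<dots> \<le> (\<Sum>z\<in>?R. ?w * (\<Sum>i\<in>UNIV. Re (?F z (x $ i) (x $ i))))"
    proof (rule sum_norm_le)
      fix z assume z: "z \<in> ?R"
      show "cmod (cnj z ^ 1 * (\<Sum>i\<in>UNIV. \<Sum>j\<in>UNIV. A $ i $ j * ?F z (x $ j) (x $ i)))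
          \<le> ?w * (\<Sum>i\<in>UNIV. Re (?F z (x $ i) (x $ i)))"
        using semidefinite_matrix_bound[OF semidefinite_fejer_form[OF B contr unit[OF z]],
            of A "Suc N" "\<lambda>i. x $ i"] unit[OF z]
        by (simp add: norm_mult)
    qed
    also have "\<dots> = ?w * (\<Sum>i\<in>UNIV. Re (\<Sum>z\<in>?R. cnj z ^ 0 * ?F z (x $ i) (x $ i)))"
      by (simp add: sum.swap[of _ ?R] flip: sum_distrib_left)
    also have "\<dots> = ?w * (\<Sum>i\<in>UNIV. real M * real (Suc N) * (norm (x $ i))\<^sup>2)"
      unfolding sum_roots_unity_fejer_form[OF M(1) zero_le_one M(2)]
      by (simp add: cinner_self del: of_nat_Suc flip: of_real_power)
    also have "\<dots> = real M * (real (Suc N) * (?w * (norm x)\<^sup>2))"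
      by (simp add: norm_vec_square sum_distrib_left mult_ac del: of_nat_Suc)
    finally show ?thesis using M(2) by (simp add: mult.assoc del: of_nat_Suc)
  qed
  show ?thesis
  proof (rule ccontr)
    assume "\<not> ?thesis"
    then have "0 < p - ?w * (norm x)\<^sup>2" by (simp add: p_def)
    then obtain N where "?w * (norm x)\<^sup>2 < real N * (p - ?w * (norm x)\<^sup>2)"
      using reals_Archimedean3 by blast
    then show False using fejer_bound[of N] by (simp add: algebra_simps)
  qed
qed

lemma numerical_radius_kronecker_op_le:
  fixes A :: "complex ^ 'n ^ 'n" and B :: "'a::complex_inner \<Rightarrow> 'a"
  assumes nz: "\<exists>x::'a. x \<noteq> 0" and B: "bounded_clinear B"
  shows "numerical_radius (kronecker_op A B) \<le> numerical_radius (\<lambda>x. A *v x) * onorm B"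
proof (rule numerical_radius_least)
  obtain u :: 'a where "u \<noteq> 0" using nz by blast
  then show "\<exists>x :: 'a ^ 'n. x \<noteq> 0"
    by (intro exI[of _ "\<chi> i. u"]) (simp add: vec_eq_iff)
  fix x :: "'a ^ 'n"
  assume x: "norm x = 1"
  note BL = bounded_clinearD(1)[OF B]
  show "cmod (cinner (kronecker_op A B x) x) \<le> numerical_radius (\<lambda>x. A *v x) * onorm B"
  proof (cases "onorm B = 0")
    case True
    then have "B v = 0" for v using onorm[OF BL, of v] by simp
    then show ?thesis by (simp add: cinner_kronecker_op True)
  next
    case False
    then have pos: "0 < onorm B" using onorm_pos_le[OF BL] by simp
    define c where "c = complex_of_real (1 / onorm B)"
    define C where "C v = c *\<^sub>C B v" for v
    have "C = (\<lambda>v. (1 / onorm B) *\<^sub>R B v)" by (simp add: C_def c_def scaleR_scaleC fun_eq_iff)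
    then have C: "bounded_clinear C"
      using bounded_linear_compose[OF bounded_linear_scaleR_right[of "1 / onorm B"] BL]
        bounded_clinearD(3)[OF B]
      by (simp add: bounded_clinear_def) (simp add: scaleR_scaleC scaleC_scaleC mult.commute)
    have "norm (C v) \<le> norm v" for v
      using onorm[OF BL, of v] pos by (simp add: C_def c_def norm_scaleC norm_divide field_simps)
    from cmod_cinner_kronecker_contraction[OF C this, of A x]
    have "cmod (cinner (kronecker_op A C x) x) \<le> numerical_radius (\<lambda>x. A *v x)"
      using x by simp
    moreover have "cinner (kronecker_op A C x) x = c * cinner (kronecker_op A B x) x"
      by (simp add: cinner_kronecker_op C_def cinner_scaleC_left sum_distrib_left mult_ac)
    ultimately show ?thesis
      using pos by (simp add: c_def norm_mult norm_divide field_simps)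
  qed
qed

section \<open>Nonnegative matrices and the equality case\<close>

text \<open>
  Only the diagonal blocks of \<open>A \<otimes> B\<close> contribute values of the quadratic form of \<open>B\<close> itself, where
  \<open>w(B)\<close> may replace \<open>\<parallel>B\<parallel>\<close>; nonnegativity of \<open>A\<close> lets the gap between the two survive in the total.
\<close>

lemma numerical_radius_kronecker_op_nonneg:
  fixes A :: "complex ^ 'n ^ 'n" and B :: "'a::complex_inner \<Rightarrow> 'a"
  assumes nz: "\<exists>x::'a. x \<noteq> 0" and B: "bounded_clinear B"
    and nonneg: "\<And>i j. A $ i $ j \<in> nonneg_Reals" and d: "\<And>i. d \<le> Re (A $ i $ i)"
  shows "numerical_radius (kronecker_op A B)
    \<le> numerical_radius (\<lambda>x. A *v x) * onorm B - d * (onorm B - numerical_radius B)"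
proof (rule numerical_radius_least)
  obtain u :: 'a where "u \<noteq> 0" using nz by blast
  then show "\<exists>x :: 'a ^ 'n. x \<noteq> 0"
    by (intro exI[of _ "\<chi> i. u"]) (simp add: vec_eq_iff)
  fix x :: "'a ^ 'n"
  assume x: "norm x = 1"
  note BL = bounded_clinearD(1)[OF B]
  define a where "a i j = Re (A $ i $ j)" for i j
  have a: "A $ i $ j = of_real (a i j)" "0 \<le> a i j" for i j
    using nonneg[of i j] by (auto simp: a_def complex_nonneg_Reals_iff complex_eq_iff)
  define gap where "gap = onorm B - numerical_radius B"
  have gap: "0 \<le> gap" using numerical_radius_le_onorm[OF nz BL] by (simp add: gap_def)
  define t where "t i = norm (x $ i)" for i
  have t: "(\<Sum>i\<in>UNIV. (t i)\<^sup>2) = 1" using x norm_vec_square[of x] by (simp add: t_def)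
  have entry: "cmod (cinner (B (x $ j)) (x $ i)) \<le> onorm B * (t j * t i) - (if j = i then gap * (t i)\<^sup>2 else 0)"
    for i j
  proof (cases "j = i")
    case True
    then show ?thesis
      using cmod_cinner_le_numerical_radius[OF B, of "x $ i"]
      by (simp add: t_def gap_def power2_eq_square algebra_simps)
  next
    case False
    then show ?thesis using cmod_cinner_le_onorm[OF BL, of "x $ j" "x $ i"] by (simp add: t_def)
  qed
  have "cmod (cinner (kronecker_op A B x) x)
      \<le> (\<Sum>i\<in>UNIV. \<Sum>j\<in>UNIV. cmod (A $ i $ j * cinner (B (x $ j)) (x $ i)))"
    unfolding cinner_kronecker_op by (intro sum_norm_le norm_sum)
  also have "\<dots> \<le> (\<Sum>i\<in>UNIV. \<Sum>j\<in>UNIV.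
      a i j * (onorm B * (t j * t i) - (if j = i then gap * (t i)\<^sup>2 else 0)))"
    using a entry by (intro sum_mono) (simp add: norm_mult mult_left_mono)
  also have "\<dots> = (\<Sum>i\<in>UNIV. \<Sum>j\<in>UNIV.
      onorm B * (a i j * (t j * t i)) - (if j = i then gap * (a i i * (t i)\<^sup>2) else 0))"
    by (intro sum.cong refl) (simp add: algebra_simps)
  also have "\<dots> = onorm B * (\<Sum>i\<in>UNIV. \<Sum>j\<in>UNIV. a i j * (t j * t i))
      - gap * (\<Sum>i\<in>UNIV. a i i * (t i)\<^sup>2)"
    by (simp add: sum_subtractf sum_distrib_left)
  also have "\<dots> \<le> onorm B * numerical_radius (\<lambda>x. A *v x) - gap * d"
  proof (intro diff_mono mult_left_mono gap onorm_pos_le BL)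
    define c where "c = (\<chi> i. complex_of_real (t i))"
    have "(norm c)\<^sup>2 = 1" by (simp add: norm_vec_square c_def t)
    moreover have "cinner (A *v c) c = of_real (\<Sum>i\<in>UNIV. \<Sum>j\<in>UNIV. a i j * (t j * t i))"
      by (simp add: cinner_matrix_vector_mult c_def a)
    ultimately have "\<bar>\<Sum>i\<in>UNIV. \<Sum>j\<in>UNIV. a i j * (t j * t i)\<bar> \<le> numerical_radius (\<lambda>x. A *v x)"
      using cmod_cinner_le_numerical_radius[OF bounded_clinear_matrix_vector_mult, of A c]
      by (simp only: norm_of_real mult_1_right)
    then show "(\<Sum>i\<in>UNIV. \<Sum>j\<in>UNIV. a i j * (t j * t i)) \<le> numerical_radius (\<lambda>x. A *v x)"
      by linarith
    have "d * (\<Sum>i\<in>UNIV. (t i)\<^sup>2) \<le> (\<Sum>i\<in>UNIV. a i i * (t i)\<^sup>2)"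
      unfolding sum_distrib_left using d by (intro sum_mono mult_right_mono) (auto simp: a_def)
    then show "d \<le> (\<Sum>i\<in>UNIV. a i i * (t i)\<^sup>2)" by (simp add: t)
  qed
  finally show "cmod (cinner (kronecker_op A B x) x)
      \<le> numerical_radius (\<lambda>x. A *v x) * onorm B - d * (onorm B - numerical_radius B)"
    by (simp add: gap_def mult.commute)
qed

theorem theorem1p4:
  fixes A :: "complex ^ 'n ^ 'n"
    and B :: "'a::complex_hilbert \<Rightarrow> 'a"
  assumes "\<exists>x::'a. x \<noteq> 0"
    and "bounded_clinear B"
  shows "(numerical_radius B = onorm B \<longrightarrow>
            numerical_radius (kronecker_op A B) = numerical_radius (\<lambda>x. A *v x) * onorm B) \<and>
         ((\<forall>i j. A $ i $ j \<in> nonneg_Reals) \<and> (\<forall>i. A $ i $ i \<noteq> 0) \<and>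
            numerical_radius (kronecker_op A B) = numerical_radius (\<lambda>x. A *v x) * onorm B \<longrightarrow>
            numerical_radius B = onorm B)"
proof (intro conjI impI)
  assume "numerical_radius B = onorm B"
  then show "numerical_radius (kronecker_op A B) = numerical_radius (\<lambda>x. A *v x) * onorm B"
    using numerical_radius_kronecker_op_le[OF assms, of A]
      numerical_radius_mult_le_kronecker_op[OF assms, of A] by simp
next
  assume *: "(\<forall>i j. A $ i $ j \<in> nonneg_Reals) \<and> (\<forall>i. A $ i $ i \<noteq> 0) \<and>
    numerical_radius (kronecker_op A B) = numerical_radius (\<lambda>x. A *v x) * onorm B"
  define d where "d = Min (range (\<lambda>i. Re (A $ i $ i)))"
  have "0 < Re (A $ i $ i)" for i
    using * by (metis complex_nonneg_Reals_iff complex_eq_iff less_eq_real_def zero_complex.sel)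
  then have pos: "0 < d" by (simp add: d_def)
  have "numerical_radius (kronecker_op A B)
      \<le> numerical_radius (\<lambda>x. A *v x) * onorm B - d * (onorm B - numerical_radius B)"
    using * by (intro numerical_radius_kronecker_op_nonneg assms) (auto simp: d_def)
  with * have "d * (onorm B - numerical_radius B) \<le> 0" by simp
  with pos have "onorm B \<le> numerical_radius B" by (simp add: mult_le_0_iff)
  then show "numerical_radius B = onorm B"
    using numerical_radius_le_onorm[OF assms(1) bounded_clinearD(1)[OF assms(2)]] by simp
qed

end
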